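(* In the region $x>\sqrt{2n}$, the Hermite polynomials admit the asymptotic representation $$H_{n}(x)\sim \Phi_{1}(x,n)=\exp\left[\frac{x^{2}-\sigma x-n}{2}+n\ln(\sigma+x)\right]\sqrt{\frac{1}{2}\left(1+\frac{x}{\sigma}\right)},\quad n\to\infty,$$ where $\sigma=\sigma(x,n)=\sqrt{x^{2}-2n}$.
   Context: $H_n$ denotes the $n$-th (physicists') Hermite polynomial, $H_{n}(x)=(-1)^{n}e^{x^{2}}\frac{d^{n}}{dx^{n}}e^{-x^{2}}$, $n=0,1,2,\ldots$. The symbol $\sim$ denotes asymptotic approximation as $n\to\infty$.
   Formalization: The asymptotics are stated along sequences x_n > sqrt(2n) with the added condition n^(1/6)(x_n - sqrt(2n)) → ∞; without it the claim fails, since Φ_1 is unbounded as x approaches sqrt(2n) at fixed n. *)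

theory Defs
  imports "HOL-Analysis.Analysis" "HOL-Library.Landau_Symbols"
begin

definition hermite :: "nat \<Rightarrow> real \<Rightarrow> real" where
  "hermite n x = (-1) ^ n * exp (x\<^sup>2) * (deriv ^^ n) (\<lambda>t. exp (- t\<^sup>2)) x"

definition hermite_sigma :: "real \<Rightarrow> nat \<Rightarrow> real" where
  "hermite_sigma x n = sqrt (x\<^sup>2 - 2 * real n)"

definition hermite_Phi1 :: "real \<Rightarrow> nat \<Rightarrow> real" where
  "hermite_Phi1 x n =
     (let \<sigma> = hermite_sigma x n
      in exp ((x\<^sup>2 - \<sigma> * x - real n) / 2 + real n * ln (\<sigma> + x)) * sqrt (1 / 2 * (1 + x / \<sigma>)))"

(* The region x > sqrt (2 n) moves with n, so a fixed x lies in it for finitely many n only.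
   Hence "hermite n x ~ hermite_Phi1 x n in the region, as n tends to infinity" is read along
   arbitrary sequences x n in the region, which amounts to uniformity in x. It cannot hold
   right up to the boundary, as hermite_Phi1 x n is unbounded for x near sqrt (2 n) at each n.
   The sequence has to leave the transition layer x - sqrt (2 n) = O(n powr (-1/6)) around
   the turning point (the scale of the Airy-type behaviour), and no other restriction is
   made. This includes x n = t * sqrt (2 n) for fixed t > 1, and every sequence with
   x n >= (1 + d) * sqrt (2 n) for a fixed d > 0. *)

end

theory Submission
  imports Defs "HOL-Probability.Characteristic_Functions"
begin

text \<open>
  For every real \<open>c\<close> the Hermite polynomial is an integral along a vertical line,
  \<open>H\<^sub>n(x) = 2\<^sup>n / sqrt pi * \<integral> (c + i t)\<^sup>n exp ((c - x + i t)\<^sup>2) dt\<close>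
  (\<open>hermite_eq_line_integral\<close>). The line is taken through the larger saddle point
  \<open>c = (x + \<sigma>) / 2\<close> of the integrand, the larger root of \<open>2 c (x - c) = n\<close>. There the integrand
  factors exactly as
  \<open>c\<^sup>n exp ((c - x)\<^sup>2) * exp (- (\<sigma> / c) t\<^sup>2) * \<phi>(t / c)\<^sup>n\<close> with
  \<open>\<phi>(u) = (1 + i u) exp (- i u - u\<^sup>2 / 2)\<close> (\<open>line_integrand_saddle\<close>). Replacing \<open>\<phi>\<close> by 1 leaves a
  Gaussian integral whose value is exactly \<open>\<Phi>\<^sub>1(x, n)\<close>.

  The error of this replacement is small uniformly in \<open>x\<close>, because \<open>\<bar>\<phi>(u)\<bar> \<le> 1\<close> and
  \<open>\<bar>\<phi>(u) - 1\<bar> \<le> \<bar>u\<bar>\<^sup>3\<close> for all real \<open>u\<close>, hence \<open>\<bar>\<phi>(u)\<^sup>n - 1\<bar> \<le> n \<bar>u\<bar>\<^sup>3\<close>; no tail of the integral has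
  to be cut off. Scaling \<open>t\<close> to the standard Gaussian gives the explicit bound
  \<open>\<bar>H\<^sub>n(x) / \<Phi>\<^sub>1(x, n) - 1\<bar> \<le> n / (sqrt pi * (c \<sigma>) powr (3/2))\<close> for every \<open>x > sqrt (2 n)\<close>
  (\<open>hermite_over_Phi1_error\<close>). With \<open>y = n powr (1/6) * (x - sqrt (2 n))\<close> the right-hand side is at
  most \<open>y powr (-3/4)\<close> (\<open>turning_point_scale\<close>), which tends to 0 because \<open>x\<close> leaves the
  transition layer around the turning point.
\<close>

section \<open>The three-term recurrence\<close>

text \<open>
  Differentiating \<open>g' = - 2 t g\<close> for the Gaussian \<open>g\<close> repeatedly gives the recurrence of its
  derivatives. As \<open>deriv\<close> is total, differentiability has to be carried along in the
  induction; for \<open>n = 0\<close> the factor \<open>n\<close> annihilates the term with the truncated index \<open>n - 1\<close>.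
\<close>

lemma gauss_higher_deriv:
  fixes D :: "nat \<Rightarrow> real \<Rightarrow> real"
  defines "D \<equiv> \<lambda>n. (deriv ^^ n) (\<lambda>t. exp (- t\<^sup>2))"
  shows "(D n has_real_derivative D (Suc n) t) (at t) \<and>
         D (Suc n) t = - 2 * t * D n t - 2 * real n * D (n - 1) t"
proof (induction n arbitrary: t rule: less_induct)
  case (less n)
  have D_Suc: "D (Suc m) = deriv (D m)" for m
    by (simp add: D_def)
  have D_der: "(D n has_real_derivative (- 2 * t * D n t - 2 * real n * D (n - 1) t)) (at t)" for t
  proof (cases n)
    case 0
    have "((\<lambda>t. exp (- t\<^sup>2)) has_real_derivative - 2 * t * exp (- t\<^sup>2)) (at t)"
      by (auto intro!: derivative_eq_intros)
    then show ?thesis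
      by (simp add: D_def 0)
  next
    case (Suc m)
    have Dm: "(D m has_real_derivative D n t) (at t)" for t
      using conjunct1[OF less.IH[of m]] Suc by simp
    have Dn: "D n = (\<lambda>t. - 2 * t * D m t - 2 * real m * D (m - 1) t)"
      using conjunct2[OF less.IH[of m]] Suc by auto
    have Dm1: "((\<lambda>t. 2 * real m * D (m - 1) t) has_real_derivative 2 * real m * D m t) (at t)"
    proof (cases m)
      case (Suc k)
      have "(D k has_real_derivative D m t) (at t)"
        using conjunct1[OF less.IH[of k]] Suc \<open>n = Suc m\<close> by simp
      then show ?thesis
        using Suc by (auto intro: DERIV_cmult)
    qed simp
    have "((\<lambda>t. - 2 * t * D m t - 2 * real m * D (m - 1) t) has_real_derivative
           (- 2 * D m t + (- 2 * t) * D n t) - 2 * real m * D m t) (at t)"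
      by (rule DERIV_diff[OF _ Dm1]) (auto intro!: derivative_eq_intros Dm)
    moreover have "(- 2 * D m t + (- 2 * t) * D n t) - 2 * real m * D m t =
        - 2 * t * D n t - 2 * real n * D (n - 1) t"
      by (simp add: Suc algebra_simps)
    ultimately have "((\<lambda>t. - 2 * t * D m t - 2 * real m * D (m - 1) t) has_real_derivative
        - 2 * t * D n t - 2 * real n * D (n - 1) t) (at t)"
      by (simp only:)
    then show ?thesis
      by (subst Dn) assumption
  qed
  then have "D (Suc n) t = - 2 * t * D n t - 2 * real n * D (n - 1) t"
    by (simp add: D_Suc DERIV_imp_deriv)
  with D_der show ?case
    by simp
qed

lemma hermite_0: "hermite 0 x = 1"
  by (simp add: hermite_def flip: exp_add)

lemma hermite_Suc: "hermite (Suc n) x = 2 * x * hermite n x - 2 * real n * hermite (n - 1) x"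
proof -
  have rec: "(deriv ^^ Suc n) (\<lambda>t. exp (- t\<^sup>2)) x =
        - 2 * x * (deriv ^^ n) (\<lambda>t. exp (- t\<^sup>2)) x
        - 2 * real n * (deriv ^^ (n - 1)) (\<lambda>t. exp (- t\<^sup>2)) x"
    using gauss_higher_deriv by blast
  show ?thesis
    unfolding hermite_def rec by (cases n) (simp_all add: algebra_simps del: funpow.simps)
qed

section \<open>Hermite polynomials as integrals along vertical lines\<close>

definition line_integrand :: "real \<Rightarrow> real \<Rightarrow> nat \<Rightarrow> real \<Rightarrow> complex" where
  "line_integrand c x n t =
     (of_real c + \<i> * of_real t) ^ n * exp ((of_real (c - x) + \<i> * of_real t)\<^sup>2)"

lemma line_integrand_has_vector_derivative:
  "(line_integrand c x n has_vector_derivative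
     \<i> * (of_nat n * line_integrand c x (n - 1) t
          + 2 * (line_integrand c x (Suc n) t - of_real x * line_integrand c x n t))) (at t)"
proof -
  have "((\<lambda>t. (of_real c + \<i> * t) ^ n * exp ((of_real (c - x) + \<i> * t)\<^sup>2)) has_field_derivative
     \<i> * (of_nat n * line_integrand c x (n - 1) t
          + 2 * (line_integrand c x (Suc n) t - of_real x * line_integrand c x n t))) (at (of_real t))"
    unfolding line_integrand_def
    by (rule derivative_eq_intros refl | simp add: algebra_simps)+
  then show ?thesis
    using has_vector_derivative_real_field unfolding line_integrand_def by blast
qed

lemma isCont_line_integrand: "isCont (line_integrand c x n) t"
  using line_integrand_has_vector_derivative has_vector_derivative_continuous by blast

lemma line_integrand_measurable: "line_integrand c x n \<in> borel_measurable lborel"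
  using borel_measurable_continuous_onI[of "line_integrand c x n"]
  by (simp add: continuous_at_imp_continuous_on isCont_line_integrand)

lemma norm_exp_line_square: "norm (exp ((of_real b + \<i> * of_real t)\<^sup>2)) = exp (b\<^sup>2 - t\<^sup>2)"
  by (simp add: norm_exp_eq_Re power2_eq_square)

text \<open>
  A crude Gaussian majorant, which gives both integrability and decay at infinity: the power is
  absorbed by \<open>r\<^sup>n \<le> n! exp r\<close>, and the resulting \<open>exp \<bar>t\<bar>\<close> by half of the Gaussian.
\<close>

lemma norm_line_integrand_le:
  "norm (line_integrand c x n t) \<le> fact n * exp ((c - x)\<^sup>2 + \<bar>c\<bar> + 1 / 2) * exp (- t\<^sup>2 / 2)"
proof -
  have "norm (complex_of_real c + \<i> * of_real t) \<le> \<bar>c\<bar> + \<bar>t\<bar>"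
    using norm_triangle_ineq[of "complex_of_real c" "\<i> * of_real t"] by (simp add: norm_mult)
  then have "norm (complex_of_real c + \<i> * of_real t) ^ n \<le> (\<bar>c\<bar> + \<bar>t\<bar>) ^ n"
    by (intro power_mono) auto
  also have "\<dots> \<le> fact n * exp (\<bar>c\<bar> + \<bar>t\<bar>)"
  proof -
    have "(\<bar>c\<bar> + \<bar>t\<bar>) ^ n /\<^sub>R fact n \<le> exp (\<bar>c\<bar> + \<bar>t\<bar>)"
      unfolding exp_def
      using sum_le_suminf[OF summable_exp_generic[of "\<bar>c\<bar> + \<bar>t\<bar>"], of "{n}"]
      by (simp add: divide_inverse)
    then show ?thesis
      by (simp add: field_simps)
  qed
  finally have pow: "norm (complex_of_real c + \<i> * of_real t) ^ n \<le> fact n * exp (\<bar>c\<bar> + \<bar>t\<bar>)" .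
  \<comment> \<open>bounds \<open>\<bar>t\<bar>\<close> by half of \<open>t\<^sup>2\<close>, up to a constant\<close>
  have "0 \<le> (\<bar>t\<bar> - 1)\<^sup>2"
    by simp
  then have t: "\<bar>t\<bar> \<le> t\<^sup>2 / 2 + 1 / 2"
    by (simp add: power2_diff)
  have "norm (line_integrand c x n t) \<le> fact n * exp (\<bar>c\<bar> + \<bar>t\<bar>) * exp ((c - x)\<^sup>2 - t\<^sup>2)"
    unfolding line_integrand_def norm_mult norm_power norm_exp_line_square
    using pow by (intro mult_right_mono) auto
  also have "\<dots> = fact n * exp ((c - x)\<^sup>2 + \<bar>c\<bar> + \<bar>t\<bar> - t\<^sup>2)"
    by (simp add: algebra_simps flip: exp_add)
  also have "\<dots> \<le> fact n * exp ((c - x)\<^sup>2 + \<bar>c\<bar> + 1 / 2 + (- t\<^sup>2 / 2))"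
    using t by (intro mult_left_mono) auto
  finally show ?thesis
    by (simp only: exp_add mult.assoc)
qed

lemma integrable_line_integrand: "integrable lborel (line_integrand c x n)"
proof (rule Bochner_Integration.integrable_bound)
  have "integrable lborel (\<lambda>t. sqrt (2 * pi) * (std_normal_density t * t ^ 0))"
    by (intro integrable_mult_right integrable_std_normal_moment)
  then have "integrable lborel (\<lambda>t::real. exp (- t\<^sup>2 / 2))"
    by (simp add: std_normal_density_def)
  then show "integrable lborel
      (\<lambda>t::real. fact n * exp ((c - x)\<^sup>2 + \<bar>c\<bar> + 1 / 2) * exp (- t\<^sup>2 / 2))"
    by (rule integrable_mult_right)
qed (use norm_line_integrand_le line_integrand_measurable in auto)

lemma line_integrand_tendsto_0:
  assumes "filterlim (\<lambda>t. t\<^sup>2) at_top F"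
  shows "(line_integrand c x n \<longlongrightarrow> 0) F"
proof (rule Lim_null_comparison)
  have "LIM t F. - t\<^sup>2 / 2 :> at_bot"
    using filterlim_tendsto_pos_mult_at_bot[OF tendsto_const[of "1 / 2 :: real"] _
        filterlim_uminus_at_top[THEN iffD1, OF assms]] by simp
  from filterlim_compose[OF exp_at_bot this]
  show "((\<lambda>t. fact n * exp ((c - x)\<^sup>2 + \<bar>c\<bar> + 1 / 2) * exp (- t\<^sup>2 / 2)) \<longlongrightarrow> 0) F"
    by (rule tendsto_mult_right_zero)
qed (intro always_eventually allI norm_line_integrand_le)

text \<open>
  Integration by parts: the integral of the derivative of the integrand vanishes. Up to the
  factor \<open>2\<^sup>n\<close> this is the recurrence of the Hermite polynomials. Its coefficients do not depend
  on \<open>c\<close>, which is why the line may later be placed through the saddle point.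
\<close>

lemma line_integral_Suc:
  "(LINT t|lborel. line_integrand c x (Suc n) t) =
     of_real x * (LINT t|lborel. line_integrand c x n t)
     - of_nat n / 2 * (LINT t|lborel. line_integrand c x (n - 1) t)"
proof -
  define f where "f = (\<lambda>t. \<i> * (of_nat n * line_integrand c x (n - 1) t
          + 2 * (line_integrand c x (Suc n) t - of_real x * line_integrand c x n t)))"
  note int = integrable_line_integrand
  have "(LBINT t=-\<infinity>..\<infinity>. f t) = 0 - 0"
  proof (rule interval_integral_FTC_integrable)
    show "(line_integrand c x n has_vector_derivative f t) (at t)" for t
      unfolding f_def by (rule line_integrand_has_vector_derivative)
    show "isCont f t" for t
      unfolding f_def by (intro continuous_intros isCont_line_integrand)
    show "set_integrable lborel (einterval (- \<infinity>) \<infinity>) f"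
      unfolding set_integrable_def einterval_eq_UNIV f_def using int by simp
    show "((line_integrand c x n \<circ> real_of_ereal) \<longlongrightarrow> 0) (at_right (- \<infinity>))"
      unfolding ereal_tendsto_simps
      by (intro line_integrand_tendsto_0 filterlim_pow_at_bot_even filterlim_ident) auto
    show "((line_integrand c x n \<circ> real_of_ereal) \<longlongrightarrow> 0) (at_left \<infinity>)"
      unfolding ereal_tendsto_simps
      by (intro line_integrand_tendsto_0 filterlim_pow_at_top filterlim_ident) auto
  qed simp
  then have "(LINT t|lborel. f t) = 0"
    by (simp add: interval_integral_to_infinity_eq interval_lebesgue_integral_def
        set_lebesgue_integral_def einterval_eq_UNIV)
  then have "of_nat n * (LINT t|lborel. line_integrand c x (n - 1) t)
      + 2 * ((LINT t|lborel. line_integrand c x (Suc n) t)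
             - of_real x * (LINT t|lborel. line_integrand c x n t)) = 0"
    unfolding f_def using int by simp
  then show ?thesis
    by (simp add: field_simps)
qed

text \<open>
  For \<open>n = 0\<close> the integral is the Fourier transform of a Gaussian, that is, up to scaling, the
  characteristic function of the standard normal distribution.
\<close>

lemma line_integral_0: "(LINT t|lborel. line_integrand c x 0 t) = sqrt pi"
proof -
  define b where "b = c - x"
  have "exp (- ((sqrt 2 * b)\<^sup>2) / 2) = char std_normal_distribution (sqrt 2 * b)"
    by (simp add: char_std_normal_distribution)
  also have "\<dots> = (LINT y|lborel. std_normal_density y *\<^sub>R iexp (sqrt 2 * b * y))"
    unfolding char_def by (subst integral_density) auto
  also have "\<dots> = \<bar>sqrt 2\<bar> *\<^sub>R
      (LINT t|lborel. std_normal_density (0 + sqrt 2 * t) *\<^sub>R iexp (sqrt 2 * b * (0 + sqrt 2 * t)))"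
    by (rule lborel_integral_real_affine) simp
  also have "(\<lambda>t. std_normal_density (0 + sqrt 2 * t) *\<^sub>R iexp (sqrt 2 * b * (0 + sqrt 2 * t))) =
      (\<lambda>t. of_real (exp (- b\<^sup>2) / sqrt (2 * pi)) * line_integrand c x 0 t)"
  proof
    fix t
    have *: "(of_real b + \<i> * of_real t)\<^sup>2 = of_real (b\<^sup>2) + (of_real (- t\<^sup>2) + \<i> * of_real (2 * b * t))"
      by (simp add: power2_eq_square algebra_simps)
    have "line_integrand c x 0 t = of_real (exp (b\<^sup>2)) * (of_real (exp (- t\<^sup>2)) * iexp (2 * b * t))"
      unfolding line_integrand_def b_def[symmetric] * exp_add by (simp only: exp_of_real power_0 mult_1_left)
    moreover have "exp (- b\<^sup>2) * exp (b\<^sup>2) = 1"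
      by (simp flip: exp_add)
    moreover have arg: "sqrt 2 * b * (0 + sqrt 2 * t) = 2 * b * t"
    proof -
      have "sqrt 2 * b * (0 + sqrt 2 * t) = (sqrt 2)\<^sup>2 * b * t"
        by (simp only: power2_eq_square add_0 ac_simps)
      then show ?thesis by simp
    qed
    ultimately show "std_normal_density (0 + sqrt 2 * t) *\<^sub>R iexp (sqrt 2 * b * (0 + sqrt 2 * t)) =
        of_real (exp (- b\<^sup>2) / sqrt (2 * pi)) * line_integrand c x 0 t"
      unfolding arg by (simp add: std_normal_density_def power_mult_distrib scaleR_conv_of_real
          mult.assoc[symmetric] flip: of_real_mult)
  qed
  finally have "complex_of_real (exp (- b\<^sup>2)) =
      of_real (sqrt 2 * (exp (- b\<^sup>2) / sqrt (2 * pi))) * (LINT t|lborel. line_integrand c x 0 t)"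
    by (simp add: power_mult_distrib scaleR_conv_of_real mult.assoc)
  also have "sqrt 2 * (exp (- b\<^sup>2) / sqrt (2 * pi)) = exp (- b\<^sup>2) / sqrt pi"
    by (simp add: real_sqrt_mult)
  finally show ?thesis
    by (simp add: field_simps)
qed

lemma hermite_eq_line_integral:
  "of_real (hermite n x) = 2 ^ n / of_real (sqrt pi) * (LINT t|lborel. line_integrand c x n t)"
proof (induction n rule: less_induct)
  case (less n)
  show ?case
  proof (cases n)
    case 0
    then show ?thesis
      by (simp add: hermite_0 line_integral_0)
  next
    case (Suc m)
    have m: "of_real (hermite m x) = 2 ^ m / of_real (sqrt pi) * (LINT t|lborel. line_integrand c x m t)"
      using less Suc by simp
    show ?thesis
    proof (cases m)
      case 0
      then show ?thesis using m \<open>n = Suc m\<close>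
        by (simp add: hermite_Suc line_integral_Suc)
    next
      case (Suc k)
      have k: "of_real (hermite k x) = 2 ^ k / of_real (sqrt pi) * (LINT t|lborel. line_integrand c x k t)"
        using less Suc \<open>n = Suc m\<close> by simp
      show ?thesis
        unfolding \<open>n = Suc m\<close> hermite_Suc[of m] line_integral_Suc[of _ _ m]
        using m k Suc by (simp del: of_real_power add: algebra_simps)
    qed
  qed
qed

section \<open>The integrand on the line through the saddle point\<close>

text \<open>
  The exponential of the remainder of \<open>ln (1 + i u)\<close> after its second-order Taylor polynomial
  \<open>i u + u\<^sup>2 / 2\<close>, written without logarithms.
\<close>

definition saddle_factor :: "real \<Rightarrow> complex" where
  "saddle_factor u = (1 + \<i> * of_real u) * exp (- (\<i> * of_real u) - of_real u ^ 2 / 2)"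

lemma norm_saddle_factor_le_1: "norm (saddle_factor u) \<le> 1"
proof -
  have "(norm (saddle_factor u))\<^sup>2 = (1 + u\<^sup>2) * exp (- u\<^sup>2)"
    unfolding saddle_factor_def norm_mult power_mult_distrib norm_exp_eq_Re
    by (simp add: cmod_power2 flip: exp_double)
  also have "\<dots> \<le> exp (u\<^sup>2) * exp (- u\<^sup>2)"
    by (intro mult_right_mono exp_ge_add_one_self) auto
  also have "\<dots> = 1"
    by (simp flip: exp_add)
  finally show ?thesis
    by (simp add: abs_square_le_1)
qed

text \<open>
  The Taylor polynomial is chosen so that the terms of lower order cancel in the derivative
  \<open>\<phi>'(u) = - i u\<^sup>2 exp (- i u - u\<^sup>2 / 2)\<close>, whose norm is at most \<open>u\<^sup>2\<close> on the real line. The mean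
  value inequality is applied to the entire extension of \<open>\<phi>\<close> on the real segment \<open>S\<close>.
\<close>

lemma norm_saddle_factor_minus_1_le: "norm (saddle_factor u - 1) \<le> \<bar>u\<bar> ^ 3"
proof -
  define f where "f = (\<lambda>z. (1 + \<i> * z) * exp (- (\<i> * z) - z ^ 2 / 2))"
  define S where "S = complex_of_real ` {-\<bar>u\<bar>..\<bar>u\<bar>}"
  have "norm (f (of_real u) - f 0) \<le> u\<^sup>2 * norm (of_real u - (0::complex))"
  proof (rule field_differentiable_bound)
    show "convex S"
      unfolding S_def by (intro convex_linear_image) (auto intro: linearI simp: scaleR_conv_of_real)
    show "(f has_field_derivative - (\<i> * z\<^sup>2 * exp (- (\<i> * z) - z ^ 2 / 2))) (at z within S)" for z
      unfolding f_def
      by (rule derivative_eq_intros refl | simp add: algebra_simps power2_eq_square)+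
    show "norm (- (\<i> * z\<^sup>2 * exp (- (\<i> * z) - z ^ 2 / 2))) \<le> u\<^sup>2" if z: "z \<in> S" for z
    proof -
      obtain v where "v \<in> {-\<bar>u\<bar>..\<bar>u\<bar>}" "z = of_real v"
        using z unfolding S_def by blast
      then have v: "z = of_real v" "\<bar>v\<bar> \<le> \<bar>u\<bar>"
        by (auto simp: abs_le_iff)
      have "norm (- (\<i> * z\<^sup>2 * exp (- (\<i> * z) - z ^ 2 / 2))) = v\<^sup>2 * exp (- v\<^sup>2 / 2)"
        by (simp add: v norm_mult norm_power norm_exp_eq_Re flip: of_real_power)
      also have "\<dots> \<le> u\<^sup>2 * 1"
        using v by (intro mult_mono) (auto simp: abs_le_square_iff)
      finally show ?thesis by simp
    qed
  qed (auto simp: S_def image_iff)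
  then show ?thesis
    by (simp add: f_def saddle_factor_def power3_eq_cube power2_eq_square)
qed

lemma norm_saddle_factor_power_minus_1_le: "norm (saddle_factor u ^ n - 1) \<le> real n * \<bar>u\<bar> ^ 3"
proof -
  have "norm (saddle_factor u ^ n - 1 ^ n) \<le> real n * norm (saddle_factor u - 1)"
    by (intro norm_power_diff norm_saddle_factor_le_1) simp
  also have "\<dots> \<le> real n * \<bar>u\<bar> ^ 3"
    by (intro mult_left_mono norm_saddle_factor_minus_1_le) simp
  finally show ?thesis by simp
qed

text \<open>
  By the saddle point equation the linear term \<open>- 2 i (x - c) s\<close> of the exponent is
  \<open>- i n s / c\<close>, which is the linear term of the exponential in \<open>saddle_factor\<close>. Of the
  quadratic term \<open>- s\<^sup>2\<close> the part \<open>- n (s / c)\<^sup>2 / 2\<close> goes there too, and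
  \<open>1 - n / (2 c\<^sup>2) = (2 c - x) / c\<close> is the coefficient that remains.
\<close>

lemma line_integrand_saddle:
  fixes n :: nat and c x s :: real
  assumes "c > 0" and saddle: "2 * c * (x - c) = real n"
  shows "line_integrand c x n s =
     of_real (c ^ n * exp ((c - x)\<^sup>2)) *
     (of_real (exp (- ((2 * c - x) / c * s\<^sup>2))) * saddle_factor (s / c) ^ n)"
proof -
  have lin: "of_real c + \<i> * of_real s = of_real c * (1 + \<i> * of_real (s / c))"
    using \<open>c > 0\<close> by (simp add: field_simps)
  have n: "real n / c = 2 * (x - c)" "real n / c\<^sup>2 = 2 * (x - c) / c"
    using assms by (simp_all add: field_simps power2_eq_square)
  have re: "(2 * c - x) / c * s\<^sup>2 + real n * ((s / c)\<^sup>2 / 2) = s\<^sup>2"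
  proof -
    have "real n * ((s / c)\<^sup>2 / 2) = real n / c\<^sup>2 * s\<^sup>2 / 2"
      by (simp add: power_divide)
    then show ?thesis
      using \<open>c > 0\<close> unfolding n by (simp add: field_simps)
  qed
  have im: "real n * (s / c) = 2 * (x - c) * s"
    using arg_cong[OF n(1), of "\<lambda>z. z * s"] by simp
  have "(of_real (c - x) + \<i> * of_real s)\<^sup>2 =
      complex_of_real ((c - x)\<^sup>2) + (of_real (- (s\<^sup>2)) - \<i> * of_real (2 * (x - c) * s))"
    by (simp add: power2_eq_square algebra_simps)
  also have "\<dots> = complex_of_real ((c - x)\<^sup>2) +
      (of_real (- ((2 * c - x) / c * s\<^sup>2 + real n * ((s / c)\<^sup>2 / 2))) - \<i> * of_real (real n * (s / c)))"
    by (simp only: re im)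
  also have "\<dots> = complex_of_real ((c - x)\<^sup>2) + (of_real (- ((2 * c - x) / c * s\<^sup>2))
      + of_nat n * (- (\<i> * of_real (s / c)) - of_real (s / c) ^ 2 / 2))"
    by (simp add: right_diff_distrib)
  finally have ex: "exp ((of_real (c - x) + \<i> * of_real s)\<^sup>2) =
      of_real (exp ((c - x)\<^sup>2)) * (of_real (exp (- ((2 * c - x) / c * s\<^sup>2)))
      * exp (- (\<i> * of_real (s / c)) - of_real (s / c) ^ 2 / 2) ^ n)"
    by (simp only: exp_add exp_of_real exp_of_nat_mult)
  show ?thesis
    unfolding line_integrand_def ex lin saddle_factor_def power_mult_distrib
    by simp
qed

lemma hermite_Phi1_saddle:
  fixes n :: nat and x :: real
  assumes x: "x > sqrt (2 * real n)"
  defines "\<sigma> \<equiv> hermite_sigma x n"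
  defines "c \<equiv> (x + \<sigma>) / 2"
  shows "\<sigma> > 0" "c > 0" "2 * c * (x - c) = real n" "2 * c - x = \<sigma>"
    and "hermite_Phi1 x n = 2 ^ n * (c ^ n * exp ((c - x)\<^sup>2)) * sqrt (c / \<sigma>)"
proof -
  have x0: "x > 0"
    using x real_sqrt_ge_zero[of "2 * real n"] by linarith
  have "2 * real n < x\<^sup>2"
    using x x0 by (metis real_less_rsqrt real_sqrt_less_iff real_sqrt_abs abs_of_pos)
  then have s2: "\<sigma>\<^sup>2 = x\<^sup>2 - 2 * real n" and s0: "\<sigma> > 0"
    by (simp_all add: \<sigma>_def hermite_sigma_def)
  show "\<sigma> > 0" by fact
  show c0: "c > 0"
    using x0 s0 by (simp add: c_def)
  show "2 * c * (x - c) = real n" "2 * c - x = \<sigma>"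
    using s2 by (simp_all add: c_def field_simps power2_eq_square)
  have e: "(x\<^sup>2 - \<sigma> * x - real n) / 2 = (c - x)\<^sup>2"
    using s2 by (simp add: c_def field_simps power2_eq_square)
  have "\<sigma> + x = 2 * c"
    by (simp add: c_def)
  then have l: "exp (real n * ln (\<sigma> + x)) = 2 ^ n * c ^ n"
    using c0 by (simp add: exp_of_nat_mult power_mult_distrib)
  have q: "1 / 2 * (1 + x / \<sigma>) = c / \<sigma>"
    using s0 by (simp add: c_def field_simps)
  show "hermite_Phi1 x n = 2 ^ n * (c ^ n * exp ((c - x)\<^sup>2)) * sqrt (c / \<sigma>)"
    unfolding hermite_Phi1_def Let_def \<sigma>_def[symmetric] e q exp_add l by simp
qed

section \<open>An explicit bound for the relative error\<close>

lemma integrable_gauss: "integrable lborel (\<lambda>t::real. exp (- t\<^sup>2))"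
  and integral_gauss: "(LINT t::real|lborel. exp (- t\<^sup>2)) = sqrt pi"
  and integrable_gauss_abs_cube: "integrable lborel (\<lambda>t::real. exp (- t\<^sup>2) * \<bar>t\<bar> ^ 3)"
  and integral_gauss_abs_cube: "(LINT t::real|lborel. exp (- t\<^sup>2) * \<bar>t\<bar> ^ 3) = 1"
proof -
  have "has_bochner_integral lborel (\<lambda>t::real. exp (- t\<^sup>2)) (sqrt pi)"
    using has_bochner_integral_even_function[OF gaussian_moment_0] by simp
  then show "integrable lborel (\<lambda>t::real. exp (- t\<^sup>2))" "(LINT t::real|lborel. exp (- t\<^sup>2)) = sqrt pi"
    by (auto simp only: has_bochner_integral_iff)
  have "has_bochner_integral lborel
      (\<lambda>t::real. indicator {0..} t *\<^sub>R (exp (- t\<^sup>2) * \<bar>t\<bar> ^ 3)) (fact 1 / 2)"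
    by (rule has_bochner_integral_cong[THEN iffD1, OF _ _ _ gaussian_moment_odd_pos[of 1]])
       (auto simp: indicator_def numeral_3_eq_3)
  from has_bochner_integral_even_function[OF this]
  have "has_bochner_integral lborel (\<lambda>t::real. exp (- t\<^sup>2) * \<bar>t\<bar> ^ 3) 1"
    by simp
  then show "integrable lborel (\<lambda>t::real. exp (- t\<^sup>2) * \<bar>t\<bar> ^ 3)"
    "(LINT t::real|lborel. exp (- t\<^sup>2) * \<bar>t\<bar> ^ 3) = 1"
    by (auto simp only: has_bochner_integral_iff)
qed

text \<open>
  After the substitution \<open>s = k t\<close> with \<open>k = sqrt (c / \<sigma>)\<close> the Gaussian factor is
  \<open>exp (- t\<^sup>2)\<close> and the argument of \<open>saddle_factor\<close> is \<open>t / d\<close> with \<open>d = sqrt (c \<sigma>)\<close>. The relative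
  error is then at most \<open>n / d\<^sup>3\<close> times the third absolute moment of \<open>exp (- t\<^sup>2)\<close>, which is 1,
  divided by the total mass \<open>sqrt pi\<close>.
\<close>

lemma hermite_over_Phi1_error:
  fixes n :: nat and x :: real
  assumes x: "x > sqrt (2 * real n)"
  defines "\<sigma> \<equiv> hermite_sigma x n"
  defines "c \<equiv> (x + \<sigma>) / 2"
  shows "\<bar>hermite n x / hermite_Phi1 x n - 1\<bar> \<le> real n / (sqrt pi * sqrt (c * \<sigma>) ^ 3)"
proof -
  note saddle = hermite_Phi1_saddle[OF x, folded \<sigma>_def, folded c_def]
  define d where "d = sqrt (c * \<sigma>)"
  define k where "k = sqrt (c / \<sigma>)"
  define A where "A = c ^ n * exp ((c - x)\<^sup>2)"
  define g where "g = (\<lambda>t. of_real (exp (- t\<^sup>2)) * saddle_factor (t / d) ^ n)"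
  have pos: "\<sigma> > 0" "c > 0" "d > 0" "k > 0" "A > 0"
    using saddle by (simp_all add: d_def k_def A_def)
  have kc: "k / c = 1 / d"
    using pos by (simp add: k_def d_def real_sqrt_divide real_sqrt_mult field_simps)
  have k2: "k\<^sup>2 = c / \<sigma>"
    using pos by (simp add: k_def)
  have scaled: "line_integrand c x n (0 + k * t) = of_real A * g t" for t
  proof -
    have "(2 * c - x) / c * (k * t)\<^sup>2 = t\<^sup>2"
      unfolding saddle power_mult_distrib k2 using pos by simp
    moreover have "k * t / c = t / d"
      using kc by (metis mult.commute mult_1 times_divide_eq_right times_divide_eq_left)
    ultimately show ?thesis
      unfolding line_integrand_saddle[OF saddle(2,3)] g_def A_def by simp
  qed
  have int_g: "integrable lborel g"
  proof -
    have "integrable lborel (\<lambda>t. line_integrand c x n (0 + k * t))"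
      using pos by (intro lborel_integrable_real_affine integrable_line_integrand) simp
    then have "integrable lborel (\<lambda>t. inverse (of_real A) * (of_real A * g t))"
      unfolding scaled by (rule integrable_mult_right)
    moreover have "inverse (complex_of_real A) * (of_real A * g t) = g t" for t
      using pos by (simp flip: mult.assoc)
    ultimately show ?thesis
      by simp
  qed
  have "(LINT t|lborel. line_integrand c x n t) = k *\<^sub>R (LINT t|lborel. line_integrand c x n (0 + k * t))"
    using lborel_integral_real_affine[of k "line_integrand c x n" 0] pos by simp
  also have "\<dots> = of_real (k * A) * (LINT t|lborel. g t)"
    unfolding scaled by (simp add: scaleR_conv_of_real)
  finally have "complex_of_real (hermite n x) =
      of_real (2 ^ n * A * k) * ((LINT t|lborel. g t) / of_real (sqrt pi))"
    unfolding hermite_eq_line_integral[of n x c] by simp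
  also have "2 ^ n * A * k = hermite_Phi1 x n"
    unfolding saddle(5) A_def k_def by simp
  finally have H: "complex_of_real (hermite n x) =
      of_real (hermite_Phi1 x n) * ((LINT t|lborel. g t) / of_real (sqrt pi))" .
  have Phi: "hermite_Phi1 x n > 0"
    using pos unfolding saddle(5) by simp
  have "(LINT t|lborel. g t) - of_real (sqrt pi) =
      (LINT t|lborel. g t) - (LINT t|lborel. complex_of_real (exp (- t\<^sup>2)))"
    by (simp only: integral_complex_of_real integral_gauss)
  also have "\<dots> = (LINT t|lborel. g t - complex_of_real (exp (- t\<^sup>2)))"
    by (intro Bochner_Integration.integral_diff[symmetric] int_g)
       (simp only: complex_of_real_integrable_eq integrable_gauss)
  finally have diff: "(LINT t|lborel. g t) - of_real (sqrt pi) = \<dots>" .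
  have "complex_of_real (hermite n x / hermite_Phi1 x n - 1) =
      ((LINT t|lborel. g t) - of_real (sqrt pi)) / of_real (sqrt pi)"
    using H Phi by (simp add: field_simps)
  from arg_cong[OF this, of norm] have "\<bar>hermite n x / hermite_Phi1 x n - 1\<bar> =
      norm (LINT t|lborel. g t - complex_of_real (exp (- t\<^sup>2))) / sqrt pi"
    unfolding diff norm_divide norm_of_real by simp
  also have "norm (LINT t|lborel. g t - complex_of_real (exp (- t\<^sup>2))) \<le>
      (LINT t|lborel. real n / d ^ 3 * (exp (- t\<^sup>2) * \<bar>t\<bar> ^ 3))"
  proof (rule Bochner_Integration.integral_norm_bound_integral)
    show "integrable lborel (\<lambda>t. g t - complex_of_real (exp (- t\<^sup>2)))"
      by (intro Bochner_Integration.integrable_diff int_g)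
         (simp only: complex_of_real_integrable_eq integrable_gauss)
    show "integrable lborel (\<lambda>t. real n / d ^ 3 * (exp (- t\<^sup>2) * \<bar>t\<bar> ^ 3))"
      by (intro integrable_mult_right integrable_gauss_abs_cube)
    fix t :: real
    have "g t - of_real (exp (- t\<^sup>2)) = of_real (exp (- t\<^sup>2)) * (saddle_factor (t / d) ^ n - 1)"
      by (simp add: g_def algebra_simps)
    then have "norm (g t - of_real (exp (- t\<^sup>2))) =
        exp (- t\<^sup>2) * norm (saddle_factor (t / d) ^ n - 1)"
      by (simp only: norm_mult norm_of_real abs_exp_cancel)
    also have "\<dots> \<le> exp (- t\<^sup>2) * (real n * \<bar>t / d\<bar> ^ 3)"
      by (intro mult_left_mono norm_saddle_factor_power_minus_1_le) simp
    also have "\<dots> = real n / d ^ 3 * (exp (- t\<^sup>2) * \<bar>t\<bar> ^ 3)"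
      using pos by (simp add: power_divide)
    finally show "norm (g t - complex_of_real (exp (- t\<^sup>2))) \<le>
        real n / d ^ 3 * (exp (- t\<^sup>2) * \<bar>t\<bar> ^ 3)" .
  qed
  also have "(LINT t|lborel. real n / d ^ 3 * (exp (- t\<^sup>2) * \<bar>t\<bar> ^ 3)) = real n / d ^ 3"
    by (simp only: integral_mult_right_zero integral_gauss_abs_cube mult_1_right)
  finally show ?thesis
    by (simp add: d_def divide_right_mono mult.commute)
qed

section \<open>Leaving the transition layer\<close>

text \<open>
  Let \<open>r = sqrt (2 n)\<close>. Since \<open>c \<ge> r / 2\<close> and \<open>\<sigma>\<^sup>2 = (x - r) (x + r) \<ge> 2 r (x - r)\<close>, the product
  \<open>(c \<sigma>)\<^sup>2\<close> is at least \<open>n r (x - r)\<close>, which is at least \<open>n powr (4/3) * y\<close>. Raised to the power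
  \<open>3/4\<close>, this compares \<open>(c \<sigma>) powr (3/2)\<close> with \<open>n\<close>: the exponent \<open>1/6\<close> in \<open>y\<close> is the one for
  which the powers of \<open>n\<close> cancel.
\<close>

lemma turning_point_scale:
  fixes n :: nat and x :: real
  assumes "n > 0" and x: "x > sqrt (2 * real n)"
  defines "\<sigma> \<equiv> hermite_sigma x n"
  defines "c \<equiv> (x + \<sigma>) / 2"
  defines "y \<equiv> real n powr (1 / 6) * (x - sqrt (2 * real n))"
  shows "real n / (sqrt pi * sqrt (c * \<sigma>) ^ 3) \<le> y powr (- 3 / 4)"
proof -
  note saddle = hermite_Phi1_saddle[OF x, folded \<sigma>_def, folded c_def]
  define r where "r = sqrt (2 * real n)"
  define d where "d = sqrt (c * \<sigma>)"
  have pos: "\<sigma> > 0" "c > 0" "d > 0" "y > 0" "r > 0"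
    using saddle x \<open>n > 0\<close> by (simp_all add: d_def y_def r_def)
  have r2: "r\<^sup>2 = 2 * real n"
    by (simp add: r_def)
  have "\<sigma>\<^sup>2 = (x - r) * (x + r)"
    using saddle(3,4) r2 by (simp add: c_def field_simps power2_eq_square)
  moreover have "(x - r) * (2 * r) \<le> (x - r) * (x + r)"
    using x by (intro mult_left_mono) (auto simp: r_def)
  ultimately have s: "2 * r * (x - r) \<le> \<sigma>\<^sup>2"
    by (simp add: algebra_simps)
  have c: "r / 2 \<le> c"
    using x pos by (simp add: c_def r_def)
  have n_le_r: "real n powr (1/2) \<le> r"
    by (simp add: r_def powr_half_sqrt)
  have "real n powr (4 / 3) * y = real n * real n powr (1 / 2) * (x - r)"
  proof -
    have "real n powr (4 / 3) * real n powr (1 / 6) = real n powr (1 + 1 / 2)"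
      by (simp flip: powr_add)
    also have "\<dots> = real n * real n powr (1 / 2)"
      using \<open>n > 0\<close> by (subst powr_add) simp
    finally show ?thesis
      by (simp add: y_def r_def)
  qed
  also have "\<dots> \<le> real n * r * (x - r)"
    using x n_le_r by (intro mult_right_mono mult_left_mono) (auto simp: r_def)
  also have "\<dots> = (r / 2)\<^sup>2 * (2 * r * (x - r))"
    using r2 by (simp add: power_divide)
  also have "\<dots> \<le> c\<^sup>2 * \<sigma>\<^sup>2"
    using c s pos x by (intro mult_mono power_mono) (auto simp: r_def)
  also have "\<dots> = d ^ 4"
    using pos by (simp add: d_def power4_eq_xxxx power2_eq_square)
  finally have "(real n powr (4 / 3) * y) powr (3 / 4) \<le> (d ^ 4) powr (3 / 4)"
    using pos by (intro powr_mono2) auto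
  also have "(d ^ 4) powr (3 / 4) = (d powr 4) powr (3 / 4)"
    using pos by simp
  also have "\<dots> = d powr 3"
    unfolding powr_powr by simp
  also have "\<dots> = d ^ 3"
    using pos by simp
  also have "(real n powr (4 / 3) * y) powr (3 / 4) = real n * y powr (3 / 4)"
    using pos by (simp add: powr_mult powr_powr)
  finally have le: "real n * y powr (3 / 4) \<le> d ^ 3" .
  have "real n / (sqrt pi * d ^ 3) \<le> real n / (1 * (real n * y powr (3 / 4)))"
    using le pos \<open>n > 0\<close> pi_ge_two by (intro divide_left_mono mult_mono) auto
  also have "\<dots> = y powr (- 3 / 4)"
    using \<open>n > 0\<close> by (simp add: powr_minus field_simps)
  finally show ?thesis
    by (simp add: d_def)
qed

theorem theorem1:
  fixes x :: "nat \<Rightarrow> real"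
  assumes "eventually (\<lambda>n. x n > sqrt (2 * real n)) at_top"
    and "filterlim (\<lambda>n. real n powr (1 / 6) * (x n - sqrt (2 * real n))) at_top at_top"
  shows "(\<lambda>n. hermite n (x n)) \<sim>[at_top] (\<lambda>n. hermite_Phi1 (x n) n)"
proof (rule asymp_equivI')
  let ?y = "\<lambda>n. real n powr (1 / 6) * (x n - sqrt (2 * real n))"
  have "(\<lambda>n. hermite n (x n) / hermite_Phi1 (x n) n - 1) \<longlonglongrightarrow> 0"
  proof (rule Lim_null_comparison)
    show "(\<lambda>n. ?y n powr (- 3 / 4)) \<longlonglongrightarrow> 0"
      using assms(2) by (intro tendsto_neg_powr) auto
    show "\<forall>\<^sub>F n in sequentially. norm (hermite n (x n) / hermite_Phi1 (x n) n - 1) \<le> ?y n powr (- 3 / 4)"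
      using assms(1) eventually_gt_at_top[of 0]
    proof eventually_elim
      case (elim n)
      then show ?case
        using order_trans[OF hermite_over_Phi1_error turning_point_scale] by simp
    qed
  qed
  then show "(\<lambda>n. hermite n (x n) / hermite_Phi1 (x n) n) \<longlonglongrightarrow> 1"
    by (rule LIM_zero_cancel)
qed

end
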